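(* Let $\Lambda$ be a locally finite preordered set that is not a poset, and let $\mathbb{F}$ be a field with at least four elements. Then the group $\mathrm{GL}_\Lambda(\mathbb{F})$ is neither solvable nor prosolvable.
   Context: For $s_1\preceq s_2$ in a preordered set $\Lambda$, $[s_1,s_2]=\{s: s_1\preceq s\preceq s_2\}$; $\Lambda$ is locally finite if all such intervals are finite. $\Lambda$ is a poset if $\preceq$ is antisymmetric. $\mathrm{M}_\Lambda(\mathbb{F})=\{(a_{s_1,s_2})\in \mathbb{F}^{\Lambda\times\Lambda}: a_{s_1,s_2}\neq 0\Rightarrow s_1\preceq s_2\}$ with coordinatewise addition and product $(ab)_{s_1,s_2}=\sum_{t\in[s_1,s_2]}a_{s_1,t}b_{t,s_2}$; $\mathrm{GL}_\Lambda(\mathbb{F})$ is its group of units. A group is prosolvable if it is an inverse limit of solvable groups. *)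

theory Defs
  imports "HOL-Algebra.Algebra"
begin

text \<open>
  The preordered set is the universe of a type of class \<open>preorder\<close>, the field is a type of
  class \<open>field\<close>; the rings and groups built from them are HOL-Algebra records.
\<close>

definition M_ring :: "('l::preorder \<Rightarrow> 'l \<Rightarrow> 'f::field) ring" where
  "M_ring =
    \<lparr> carrier = {a. \<forall>s t. a s t \<noteq> 0 \<longrightarrow> s \<le> t},
      monoid.mult = (\<lambda>a b s u. \<Sum>t\<in>{s..u}. a s t * b t u),
      monoid.one = (\<lambda>s t. if s = t then 1 else 0),
      ring.zero = (\<lambda>s t. 0),
      ring.add = (\<lambda>a b s t. a s t + b s t) \<rparr>"

definition GL_group :: "('l::preorder \<Rightarrow> 'l \<Rightarrow> 'f::field) monoid" where
  "GL_group = units_of M_ring"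

text \<open>
  \<open>f i j\<close>, for \<open>leq i j\<close>, is the transition map from \<open>H j\<close> to \<open>H i\<close>. The index set is a nonempty
  directed preordered set; antisymmetry is not required.
\<close>

definition inverse_system ::
  "'i set \<Rightarrow> ('i \<Rightarrow> 'i \<Rightarrow> bool) \<Rightarrow> ('i \<Rightarrow> 'h monoid) \<Rightarrow> ('i \<Rightarrow> 'i \<Rightarrow> 'h \<Rightarrow> 'h) \<Rightarrow> bool" where
  "inverse_system I leq H f \<longleftrightarrow>
     I \<noteq> {} \<and> reflp_on I leq \<and> transp_on I leq \<and>
     (\<forall>i\<in>I. \<forall>j\<in>I. \<exists>k\<in>I. leq i k \<and> leq j k) \<and>
     (\<forall>i\<in>I. group (H i)) \<and>
     (\<forall>i\<in>I. \<forall>j\<in>I. leq i j \<longrightarrow> f i j \<in> hom (H j) (H i)) \<and>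
     (\<forall>i\<in>I. \<forall>x\<in>carrier (H i). f i i x = x) \<and>
     (\<forall>i\<in>I. \<forall>j\<in>I. \<forall>k\<in>I. leq i j \<longrightarrow> leq j k \<longrightarrow>
        (\<forall>x\<in>carrier (H k). f i j (f j k x) = f i k x))"

definition inverse_limit ::
  "'i set \<Rightarrow> ('i \<Rightarrow> 'i \<Rightarrow> bool) \<Rightarrow> ('i \<Rightarrow> 'h monoid) \<Rightarrow> ('i \<Rightarrow> 'i \<Rightarrow> 'h \<Rightarrow> 'h) \<Rightarrow> ('i \<Rightarrow> 'h) monoid" where
  "inverse_limit I leq H f =
     (product_group I H)\<lparr> carrier :=
        {x \<in> carrier (product_group I H). \<forall>i\<in>I. \<forall>j\<in>I. leq i j \<longrightarrow> f i j (x j) = x i} \<rparr>"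

text \<open>
  HOL cannot quantify existentially over types inside a formula, so the type \<open>'i\<close> of indices and
  the type \<open>'h\<close> containing the groups of the system are parameters. A group fails to be
  prosolvable when \<open>\<not> prosolvable TYPE('i) TYPE('h) G\<close> holds for all types \<open>'i\<close> and \<open>'h\<close>.
\<close>

definition prosolvable :: "'i itself \<Rightarrow> 'h itself \<Rightarrow> ('a, 'b) monoid_scheme \<Rightarrow> bool" where
  "prosolvable _ _ G \<longleftrightarrow>
     (\<exists>(I :: 'i set) leq (H :: 'i \<Rightarrow> 'h monoid) f.
        inverse_system I leq H f \<and> (\<forall>i\<in>I. solvable (H i)) \<and> G \<cong> inverse_limit I leq H f)"


lemma M_ring_closed:
  fixes a b :: "'l::preorder \<Rightarrow> 'l \<Rightarrow> 'f::field"
  shows "a \<otimes>\<^bsub>M_ring\<^esub> b \<in> carrier M_ring"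
proof -
  have "s \<le> u" if nz: "(\<Sum>t\<in>{s..u}. a s t * b t u) \<noteq> 0" for s u
  proof -
    have "{s..u} \<noteq> {}" using nz by (metis sum.empty)
    then show ?thesis by simp
  qed
  then show ?thesis unfolding M_ring_def monoid.simps partial_object.simps by blast
qed

lemma ring_M_ring:
  assumes fin: "\<And>s t :: 'l::preorder. finite {s..t}"
  shows "ring (M_ring :: ('l \<Rightarrow> 'l \<Rightarrow> 'f::field) ring)" (is "ring ?R")
proof (rule ringI)
  show "abelian_group ?R"
  proof (rule abelian_groupI)
    fix x y assume "x \<in> carrier ?R" "y \<in> carrier ?R"
    then show "x \<oplus>\<^bsub>?R\<^esub> y \<in> carrier ?R"
      by (simp add: M_ring_def) (metis add_0)
  next
    fix x assume "x \<in> carrier ?R"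
    then have "(\<lambda>s t. - x s t) \<in> carrier ?R" "(\<lambda>s t. - x s t) \<oplus>\<^bsub>?R\<^esub> x = \<zero>\<^bsub>?R\<^esub>"
      by (auto simp: M_ring_def)
    then show "\<exists>y\<in>carrier ?R. y \<oplus>\<^bsub>?R\<^esub> x = \<zero>\<^bsub>?R\<^esub>" by blast
  qed (auto simp: M_ring_def algebra_simps)
  show "monoid ?R"
  proof (rule monoidI)
    fix x y show "x \<otimes>\<^bsub>?R\<^esub> y \<in> carrier ?R" by (rule M_ring_closed)
  next
    show "\<one>\<^bsub>?R\<^esub> \<in> carrier ?R" by (simp add: M_ring_def)
  next
    fix x y z :: "'l \<Rightarrow> 'l \<Rightarrow> 'f"
    have "(\<Sum>t\<in>{s..u}. (\<Sum>r\<in>{s..t}. x s r * y r t) * z t u)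
        = (\<Sum>r\<in>{s..u}. x s r * (\<Sum>t\<in>{r..u}. y r t * z t u))" for s u
    proof -
      have lower: "{r \<in> {s..u}. r \<le> t} = {s..t}" if "t \<in> {s..u}" for t
        using that unfolding set_eq_iff atLeastAtMost_iff mem_Collect_eq by (meson order_trans)
      have upper: "{t \<in> {s..u}. r \<le> t} = {r..u}" if "r \<in> {s..u}" for r
        using that unfolding set_eq_iff atLeastAtMost_iff mem_Collect_eq by (meson order_trans)
      have "(\<Sum>t\<in>{s..u}. (\<Sum>r\<in>{s..t}. x s r * y r t) * z t u)
          = (\<Sum>t\<in>{s..u}. \<Sum>r\<in>{r \<in> {s..u}. r \<le> t}. x s r * y r t * z t u)"
        by (intro sum.cong refl) (simp only: sum_distrib_right lower)
      also have "\<dots> = (\<Sum>r\<in>{s..u}. \<Sum>t\<in>{t \<in> {s..u}. r \<le> t}. x s r * y r t * z t u)"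
        by (rule sum.swap_restrict) (rule fin)+
      also have "\<dots> = (\<Sum>r\<in>{s..u}. x s r * (\<Sum>t\<in>{r..u}. y r t * z t u))"
        by (intro sum.cong refl) (simp only: sum_distrib_left upper mult.assoc)
      finally show ?thesis .
    qed
    then show "x \<otimes>\<^bsub>?R\<^esub> y \<otimes>\<^bsub>?R\<^esub> z = x \<otimes>\<^bsub>?R\<^esub> (y \<otimes>\<^bsub>?R\<^esub> z)"
      by (simp add: M_ring_def)
  next
    fix x assume x: "x \<in> carrier ?R"
    have x0: "x s t = 0" if "\<not> s \<le> t" for s t using x that by (auto simp: M_ring_def)
    have *: "(\<Sum>t\<in>{s..u}. (if s = t then 1 else 0) * x t u) = x s u"
            "(\<Sum>t\<in>{s..u}. x s t * (if t = u then 1 else 0)) = x s u" for s u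
      using fin[of s u] x0[of s u] by (auto simp: if_distrib if_distribR cong: if_cong)
    show "\<one>\<^bsub>?R\<^esub> \<otimes>\<^bsub>?R\<^esub> x = x" "x \<otimes>\<^bsub>?R\<^esub> \<one>\<^bsub>?R\<^esub> = x"
      using * by (simp_all add: M_ring_def)
  qed
next
  fix x y z :: "'l \<Rightarrow> 'l \<Rightarrow> 'f"
  show "(x \<oplus>\<^bsub>?R\<^esub> y) \<otimes>\<^bsub>?R\<^esub> z = x \<otimes>\<^bsub>?R\<^esub> z \<oplus>\<^bsub>?R\<^esub> y \<otimes>\<^bsub>?R\<^esub> z"
    by (simp add: M_ring_def distrib_right sum.distrib)
  show "z \<otimes>\<^bsub>?R\<^esub> (x \<oplus>\<^bsub>?R\<^esub> y) = z \<otimes>\<^bsub>?R\<^esub> x \<oplus>\<^bsub>?R\<^esub> z \<otimes>\<^bsub>?R\<^esub> y"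
    by (simp add: M_ring_def distrib_left sum.distrib)
qed

lemma group_GL_group:
  assumes "\<And>s t :: 'l::preorder. finite {s..t}"
  shows "group (GL_group :: ('l \<Rightarrow> 'l \<Rightarrow> 'f::field) monoid)"
  unfolding GL_group_def
  using assms by (rule monoid.units_group[OF ring.is_monoid[OF ring_M_ring]])

lemma solvable_imp_prosolvable:
  fixes G :: "'a monoid"
  assumes "group G" "solvable G"
  shows "prosolvable TYPE(unit) TYPE('a) G"
proof -
  let ?L = "inverse_limit {()} (\<lambda>_ _. True) (\<lambda>_. G) (\<lambda>_ _ x. x)"
  have sys: "inverse_system {()} (\<lambda>_ _. True) (\<lambda>_. G) (\<lambda>_ _ x. x)"
    using assms by (simp add: inverse_system_def hom_def reflp_on_def transp_on_def)
  have "bij_betw (\<lambda>g. \<lambda>_\<in>{()}. g) (carrier G) (carrier ?L)"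
    by (rule bij_betw_byWitness[where f' = "\<lambda>x. x ()"])
       (auto simp: inverse_limit_def)
  then have "(\<lambda>g. \<lambda>_\<in>{()}. g) \<in> iso G ?L"
    by (auto simp: iso_def hom_def inverse_limit_def)
  then show ?thesis
    using sys assms unfolding prosolvable_def is_iso_def by blast
qed

end

theory Submission
  imports Defs
begin

text \<open>
  If \<open>p \<noteq> q\<close> and \<open>p \<le> q \<le> p\<close>, then SL2 embeds into the group as the matrices that differ from the
  identity only in rows and columns \<open>p\<close> and \<open>q\<close>. Choose \<open>u\<close> with \<open>u\<^sup>2 \<noteq> 0, 1\<close>. Every elementary
  matrix of SL2 is a commutator of the diagonal matrix with entries \<open>u\<close>, \<open>1/u\<close> and an elementary
  matrix, and every diagonal matrix of SL2 is a product of elementary ones. Hence the set of these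
  matrices lies in the derived subgroup it determines, so every homomorphism to a solvable group
  kills it; the projections of an inverse limit of solvable groups would then not separate points.
\<close>

text \<open>The image of \<open>K\<close> again lies in its own derived subgroup, so by monotonicity
  it lies in every term of the derived series of \<open>H\<close>, which ends at the trivial
  group.\<close>

lemma (in group_hom) img_trivial_if_subset_derived:
  assumes "solvable H" "K \<subseteq> carrier G" "K \<subseteq> derived G K"
  shows "h ` K \<subseteq> {\<one>\<^bsub>H\<^esub>}"
proof -
  have img: "h ` K \<subseteq> carrier H"
    using assms(2) by auto
  have *: "h ` K \<subseteq> derived H (h ` K)"
    using derived_img[OF assms(2)] image_mono[OF assms(3), of h] by simp
  have "h ` K \<subseteq> (derived H ^^ n) (carrier H)" for n
  proof (induction n)
    case (Suc n)
    have "derived H (h ` K) \<subseteq> derived H ((derived H ^^ n) (carrier H))"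
      by (rule H.mono_derived[OF Suc.IH])
    then show ?case using * by auto
  qed (simp add: img)
  then show ?thesis
    using assms(1) H.solvable_iff_trivial_derived_seq by metis
qed

text \<open>The determinant is left free, so that the product formula carries no side condition; it
  is set to 1 where inverses are taken.\<close>

definition SL2_emb :: "'l \<Rightarrow> 'l \<Rightarrow> 'f \<Rightarrow> 'f \<Rightarrow> 'f \<Rightarrow> 'f \<Rightarrow> 'l::preorder \<Rightarrow> 'l \<Rightarrow> 'f::field" where
  "SL2_emb p q a b c d s t =
     (if s = p then if t = p then a else if t = q then b else 0
      else if s = q then if t = p then c else if t = q then d else 0
      else if s = t then 1 else 0)"

lemma SL2_emb_in_M_ring:
  assumes "p \<le> q" "q \<le> p"
  shows "SL2_emb p q a b c d \<in> carrier M_ring"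
  using assms by (auto simp: M_ring_def SL2_emb_def)

lemma SL2_emb_one: "SL2_emb p q 1 0 0 1 = \<one>\<^bsub>M_ring\<^esub>"
  by (auto simp: M_ring_def SL2_emb_def fun_eq_iff)

lemma SL2_emb_mult:
  assumes fin: "\<And>s t :: 'l::preorder. finite {s..t}"
    and pq: "p \<noteq> q" "p \<le> q" "q \<le> p"
  shows "SL2_emb p q a b c d \<otimes>\<^bsub>M_ring\<^esub> SL2_emb (p :: 'l) q a' b' c' d' =
    (SL2_emb p q (a * a' + b * c') (a * b' + b * d') (c * a' + d * c') (c * b' + d * d')
      :: 'l \<Rightarrow> 'l \<Rightarrow> 'f::field)"
proof -
  let ?A = "SL2_emb p q a b c d" and ?B = "SL2_emb p q a' b' c' d'"
  let ?C = "SL2_emb p q (a * a' + b * c') (a * b' + b * d') (c * a' + d * c') (c * b' + d * d')"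
  have "(\<Sum>t\<in>{s..u}. ?A s t * ?B t u) = ?C s u" for s u
  proof (cases "s \<in> {p, q}")
    case s: True
    show ?thesis
    proof (cases "u \<in> {p, q}")
      case u: True
      have "{p, q} \<subseteq> {s..u}"
        using s u pq by auto
      \<comment> \<open>The interval may contain further elements equivalent to \<open>p\<close>;
        row \<open>s\<close> of \<open>?A\<close> vanishes there.\<close>
      then have "(\<Sum>t\<in>{s..u}. ?A s t * ?B t u) = (\<Sum>t\<in>{p, q}. ?A s t * ?B t u)"
        using s fin by (intro sum.mono_neutral_right) (auto simp: SL2_emb_def)
      then show ?thesis
        using s u pq(1) by (auto simp: SL2_emb_def)
    next
      case u: False
      have "(\<Sum>t\<in>{s..u}. ?A s t * ?B t u) = 0"
        using s u by (intro sum.neutral) (auto simp: SL2_emb_def)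
      then show ?thesis
        using s u by (auto simp: SL2_emb_def)
    qed
  next
    case s: False
    have "(\<Sum>t\<in>{s..u}. ?A s t * ?B t u) = (\<Sum>t\<in>{s..u}. if t = s then ?B s u else 0)"
      using s by (intro sum.cong) (auto simp: SL2_emb_def)
    also have "\<dots> = ?C s u"
      using s fin[of s u] by (auto simp: SL2_emb_def)
    finally show ?thesis .
  qed
  then show ?thesis
    by (simp add: M_ring_def fun_eq_iff)
qed

lemma GL_group_simps [simp]:
  "carrier GL_group = Units M_ring" "monoid.mult GL_group = monoid.mult M_ring"
  "\<one>\<^bsub>GL_group\<^esub> = \<one>\<^bsub>M_ring\<^esub>"
  by (simp_all add: GL_group_def units_of_def)

text \<open>The inverse is the embedded adjugate.\<close>

lemma SL2_emb_in_Units: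
  assumes fin: "\<And>s t :: 'l::preorder. finite {s..t}"
    and pq: "(p :: 'l) \<noteq> q" "p \<le> q" "q \<le> p"
    and det: "a * d - b * c = (1 :: 'f::field)"
  shows "SL2_emb p q a b c d \<in> Units M_ring"
proof -
  have "SL2_emb p q d (- b) (- c) a \<otimes>\<^bsub>M_ring\<^esub> SL2_emb p q a b c d = \<one>\<^bsub>M_ring\<^esub>"
    "SL2_emb p q a b c d \<otimes>\<^bsub>M_ring\<^esub> SL2_emb p q d (- b) (- c) a = \<one>\<^bsub>M_ring\<^esub>"
    unfolding SL2_emb_one[symmetric, of p q] SL2_emb_mult[OF fin pq] using det
    by (simp_all add: algebra_simps)
  then show ?thesis
    using SL2_emb_in_M_ring[OF pq(2,3)] unfolding Units_def by blast
qed

lemma SL2_emb_inv: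
  assumes fin: "\<And>s t :: 'l::preorder. finite {s..t}"
    and pq: "(p :: 'l) \<noteq> q" "p \<le> q" "q \<le> p"
    and det: "a * d - b * c = (1 :: 'f::field)"
  shows "inv\<^bsub>GL_group\<^esub> SL2_emb p q a b c d = SL2_emb p q d (- b) (- c) a"
proof (rule group.inv_equality[OF group_GL_group[OF fin]])
  show "SL2_emb p q d (- b) (- c) a \<otimes>\<^bsub>GL_group\<^esub> SL2_emb p q a b c d = \<one>\<^bsub>GL_group\<^esub>"
    unfolding GL_group_simps SL2_emb_one[symmetric, of p q] SL2_emb_mult[OF fin pq] using det
    by (simp add: algebra_simps)
qed (use det in \<open>auto intro!: SL2_emb_in_Units[OF fin pq] simp: algebra_simps\<close>)

text \<open>The two root subgroups and the diagonal torus of SL2. Their union is not a subgroup, but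
  \<open>derived\<close> accepts any set and generates from its commutators.\<close>

definition SL2_generators :: "'l \<Rightarrow> 'l \<Rightarrow> ('l::preorder \<Rightarrow> 'l \<Rightarrow> 'f::field) set" where
  "SL2_generators p q = range (\<lambda>b. SL2_emb p q 1 b 0 1) \<union> range (\<lambda>c. SL2_emb p q 1 0 c 1)
     \<union> (\<lambda>u. SL2_emb p q u 0 0 (1 / u)) ` (- {0})"

lemma SL2_generators_subset_carrier:
  assumes "\<And>s t :: 'l::preorder. finite {s..t}" "(p :: 'l) \<noteq> q" "p \<le> q" "q \<le> p"
  shows "SL2_generators p q \<subseteq> carrier (GL_group :: ('l \<Rightarrow> 'l \<Rightarrow> 'f::field) monoid)"
  unfolding SL2_generators_def by (auto intro!: SL2_emb_in_Units[OF assms] split: if_splits)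

lemma SL2_generators_subset_derived:
  assumes fin: "\<And>s t :: 'l::preorder. finite {s..t}"
    and pq: "(p :: 'l) \<noteq> q" "p \<le> q" "q \<le> p"
    and u: "u \<noteq> 0" "u\<^sup>2 \<noteq> (1 :: 'f::field)"
  shows "SL2_generators p q \<subseteq> derived (GL_group :: ('l \<Rightarrow> 'l \<Rightarrow> 'f) monoid) (SL2_generators p q)"
proof -
  let ?G = "GL_group :: ('l \<Rightarrow> 'l \<Rightarrow> 'f) monoid" and ?K = "SL2_generators p q :: ('l \<Rightarrow> 'l \<Rightarrow> 'f) set"
  let ?x = "\<lambda>b. SL2_emb p q 1 b 0 1 :: 'l \<Rightarrow> 'l \<Rightarrow> 'f" and ?y = "\<lambda>c. SL2_emb p q 1 0 c 1"
    and ?h = "\<lambda>u. SL2_emb p q u 0 0 (1 / u)"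
  note mult = SL2_emb_mult[OF fin pq] and inv = SL2_emb_inv[OF fin pq]
  have K: "?x b \<in> ?K" "?y b \<in> ?K" "?h u \<in> ?K" for b
    using u by (auto simp: SL2_generators_def)
  have commutator: "g \<otimes>\<^bsub>?G\<^esub> k \<otimes>\<^bsub>?G\<^esub> inv\<^bsub>?G\<^esub> g \<otimes>\<^bsub>?G\<^esub> inv\<^bsub>?G\<^esub> k \<in> derived ?G ?K"
    if "g \<in> ?K" "k \<in> ?K" for g k
    unfolding derived_def using that by (blast intro: generate.incl)
  have closed: "g \<otimes>\<^bsub>?G\<^esub> k \<in> derived ?G ?K" if "g \<in> derived ?G ?K" "k \<in> derived ?G ?K" for g k
    using that unfolding derived_def by (rule generate.eng)
  have x: "?x b \<in> derived ?G ?K" for b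
  proof -
    \<comment> \<open>Conjugation by \<open>?h u\<close> scales the upper entry by the square of
      \<open>u\<close>, and the lower entry below by its reciprocal. Both factors differ from 1, so
      \<open>k\<close> can be chosen to reach any entry.\<close>
    have "?h u \<otimes>\<^bsub>?G\<^esub> ?x k \<otimes>\<^bsub>?G\<^esub> inv\<^bsub>?G\<^esub> ?h u \<otimes>\<^bsub>?G\<^esub> inv\<^bsub>?G\<^esub> ?x k = ?x ((u\<^sup>2 - 1) * k)" for k
      using u(1) by (simp add: mult inv) (simp add: algebra_simps power2_eq_square)
    then have "?x ((u\<^sup>2 - 1) * (b / (u\<^sup>2 - 1))) \<in> derived ?G ?K"
      using commutator[OF K(3) K(1)] by metis
    then show ?thesis
      using u(2) by simp
  qed
  have y: "?y c \<in> derived ?G ?K" for c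
  proof -
    have "?h u \<otimes>\<^bsub>?G\<^esub> ?y k \<otimes>\<^bsub>?G\<^esub> inv\<^bsub>?G\<^esub> ?h u \<otimes>\<^bsub>?G\<^esub> inv\<^bsub>?G\<^esub> ?y k = ?y ((1 / u\<^sup>2 - 1) * k)" for k
      using u(1) by (simp add: mult inv) (simp add: algebra_simps power2_eq_square)
    then have "?y ((1 / u\<^sup>2 - 1) * (c / (1 / u\<^sup>2 - 1))) \<in> derived ?G ?K"
      using commutator[OF K(3) K(2)] by metis
    moreover have "1 / u\<^sup>2 - 1 \<noteq> 0"
      using u by (metis divide_eq_1_iff right_minus_eq)
    ultimately show ?thesis
      by (metis nonzero_mult_div_cancel_left times_divide_eq_right)
  qed
  have h: "?h v \<in> derived ?G ?K" if "v \<noteq> 0" for v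
  proof -
    \<comment> \<open>Each bracket is an antidiagonal Weyl element, with upper entry
      \<open>v\<close> and \<open>- 1\<close> respectively; their product is diagonal.\<close>
    have "(?x v \<otimes>\<^bsub>?G\<^esub> ?y (- 1 / v) \<otimes>\<^bsub>?G\<^esub> ?x v) \<otimes>\<^bsub>?G\<^esub> (?x (- 1) \<otimes>\<^bsub>?G\<^esub> ?y 1 \<otimes>\<^bsub>?G\<^esub> ?x (- 1)) = ?h v"
      using that by (simp add: mult)
    then show ?thesis
      using closed x y by metis
  qed
  show ?thesis
    using x y h by (auto simp: SL2_generators_def)
qed

text \<open>Only the at most three values 0, 1 and -1 are excluded.\<close>

lemma exists_nonzero_square_neq_one:
  assumes "infinite (UNIV :: 'f::field set) \<or> card (UNIV :: 'f set) \<ge> 4"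
  obtains u :: "'f::field" where "u \<noteq> 0" "u\<^sup>2 \<noteq> 1"
proof -
  have "card {0, 1, - 1 :: 'f} \<le> 3"
    by (simp add: card_insert_if)
  moreover have "finite {0, 1, - 1 :: 'f}"
    by simp
  ultimately have "{0, 1, - 1 :: 'f} \<noteq> UNIV"
    using assms by force
  then show ?thesis
    using that by (auto simp: power2_eq_1_iff)
qed

lemma prosolvable_separated:
  fixes G :: "('a, 'b) monoid_scheme"
  assumes "group G" "prosolvable TYPE('i) TYPE('h) G"
    and "K \<subseteq> carrier G" "K \<subseteq> derived G K" "x \<in> K" "y \<in> K"
  shows "x = y"
proof -
  obtain I :: "'i set" and leq and H :: "'i \<Rightarrow> 'h monoid" and f
    where sys: "inverse_system I leq H f" and solv: "\<And>i. i \<in> I \<Longrightarrow> solvable (H i)"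
      and "G \<cong> inverse_limit I leq H f"
    using assms(2) unfolding prosolvable_def by blast
  then obtain g where g: "g \<in> hom G (inverse_limit I leq H f)" and inj: "inj_on g (carrier G)"
    unfolding is_iso_def iso_def bij_betw_def by blast
  \<comment> \<open>Members of the limit are extensional on \<open>I\<close>, so agreement of all
    projections forces equality.\<close>
  have ext: "g z \<in> (\<Pi>\<^sub>E i\<in>I. carrier (H i))" if "z \<in> carrier G" for z
    using g that by (auto simp: hom_def inverse_limit_def)
  have "g z i = \<one>\<^bsub>H i\<^esub>" if "i \<in> I" "z \<in> K" for i z
  proof -
    have "(\<lambda>z. g z i) \<in> hom G (H i)"
      using g ext \<open>i \<in> I\<close> by (auto simp: hom_def inverse_limit_def)
    then interpret group_hom G "H i" "\<lambda>z. g z i"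
      using assms(1) sys \<open>i \<in> I\<close>
      by (simp add: group_hom_def group_hom_axioms_def inverse_system_def)
    show ?thesis
      using img_trivial_if_subset_derived[OF solv assms(3,4)] that by blast
  qed
  moreover have "x \<in> carrier G" "y \<in> carrier G"
    using assms by auto
  ultimately have "g x = g y"
    using assms(5,6) by (intro PiE_ext[OF ext ext]) auto
  then show ?thesis
    using inj \<open>x \<in> carrier G\<close> \<open>y \<in> carrier G\<close> by (auto dest: inj_onD)
qed

theorem proposition5p8:
  assumes locally_finite: "\<forall>s t :: 'l::preorder. finite {s..t}"
    and not_poset: "\<not> antisymp ((\<le>) :: 'l \<Rightarrow> 'l \<Rightarrow> bool)"
    and four_elements: "infinite (UNIV :: 'f::field set) \<or> card (UNIV :: 'f set) \<ge> 4"
  shows "\<not> solvable (GL_group :: ('l \<Rightarrow> 'l \<Rightarrow> 'f) monoid) \<and>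
    \<not> prosolvable TYPE('i) TYPE('h) (GL_group :: ('l \<Rightarrow> 'l \<Rightarrow> 'f) monoid)"
proof -
  let ?G = "GL_group :: ('l \<Rightarrow> 'l \<Rightarrow> 'f) monoid"
  have fin: "finite {s..t}" for s t :: 'l
    using locally_finite by blast
  have G: "group ?G"
    by (rule group_GL_group[OF fin])
  obtain p q :: 'l where pq: "p \<noteq> q" "p \<le> q" "q \<le> p"
    using not_poset unfolding antisymp_def antisymp_on_def by blast
  obtain u :: 'f where u: "u \<noteq> 0" "u\<^sup>2 \<noteq> 1"
    using exists_nonzero_square_neq_one[OF four_elements] .
  let ?x = "\<lambda>b. SL2_emb p q 1 b 0 1 :: 'l \<Rightarrow> 'l \<Rightarrow> 'f"
  have "?x 0 p q \<noteq> ?x 1 p q"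
    using pq by (simp add: SL2_emb_def)
  then have "?x 0 \<noteq> ?x 1"
    by metis
  moreover have "?x 0 \<in> SL2_generators p q" "?x 1 \<in> SL2_generators p q"
    by (auto simp: SL2_generators_def)
  \<comment> \<open>The fresh type variables make this fact polymorphic: it is used once at the
    given types and once at those of the one-point system that presents a solvable group as
    prosolvable.\<close>
  ultimately have not_pro: "\<not> prosolvable TYPE('j) TYPE('k) ?G"
    using prosolvable_separated[OF G _ SL2_generators_subset_carrier[OF fin pq]
        SL2_generators_subset_derived[OF fin pq u]] by blast
  show ?thesis
    by (intro conjI not_pro contrapos_nn[OF not_pro solvable_imp_prosolvable[OF G]])
qed

end
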